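(* Let $W$ be a Coxeter group of type $F_4$, and let $F_4(a_1)$ be the Carter diagram that is a 4-cycle on vertices $s_1,s_2,s_3,s_4$ with double edges $s_1s_4$ and $s_2s_3$ and single edges $s_1s_2$ and $s_3s_4$. Then the Artin group $A(F_4)$ admits a presentation over generators $\boldsymbol{s}_1,\boldsymbol{s}_2,\boldsymbol{s}_3,\boldsymbol{s}_4$ corresponding to the vertices of $F_4(a_1)$ with relations $R(F_4(a_1))$ and the commutator relator $[\boldsymbol{s}_2,\boldsymbol{s}_3]$.
   Context: $A(F_4)$ is the Artin group of the Coxeter diagram $F_4$. $R(F_4(a_1))$ is the set of braid relations defined by the diagram: $\boldsymbol{s}\boldsymbol{t}\boldsymbol{s}\boldsymbol{t}=\boldsymbol{t}\boldsymbol{s}\boldsymbol{t}\boldsymbol{s}$ for vertices joined by a double edge, $\boldsymbol{s}\boldsymbol{t}\boldsymbol{s}=\boldsymbol{t}\boldsymbol{s}\boldsymbol{t}$ for vertices joined by a single edge, and $\boldsymbol{s}\boldsymbol{t}=\boldsymbol{t}\boldsymbol{s}$ for vertices not joined. $[a,b]$ is the commutator. *)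

theory Defs
  imports "HOL-Algebra.Coset" "HOL.Hull"
begin

section \<open>Free groups\<close>

text \<open>A word is a list of letters; \<open>(a, True)\<close> is the letter \<open>a\<close> and \<open>(a, False)\<close> its formal
  inverse.\<close>

type_synonym 'a word = "('a \<times> bool) list"

definition words :: "'a set \<Rightarrow> 'a word set" where
  "words S = lists (S \<times> UNIV)"

inductive cancels :: "'a set \<Rightarrow> 'a word \<Rightarrow> 'a word \<Rightarrow> bool" for S where
  "a \<in> S \<Longrightarrow> cancels S (u @ [(a, e), (a, \<not> e)] @ v) (u @ v)"

definition free_rel :: "'a set \<Rightarrow> ('a word \<times> 'a word) set" where
  "free_rel S = {(u, v). u \<in> words S \<and> v \<in> words S \<and> equivclp (cancels S) u v}"

definition free_group :: "'a set \<Rightarrow> 'a word set monoid" where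
  "free_group S = \<lparr>carrier = words S // free_rel S,
     mult = (\<lambda>A B. \<Union>u\<in>A. \<Union>v\<in>B. free_rel S `` {u @ v}),
     one = free_rel S `` {[]}\<rparr>"

definition free_gen :: "'a set \<Rightarrow> 'a \<Rightarrow> 'a word set" where
  "free_gen S a = free_rel S `` {[(a, True)]}"


section \<open>Presentations\<close>

definition normal_closure :: "('g, 'm) monoid_scheme \<Rightarrow> 'g set \<Rightarrow> 'g set" where
  "normal_closure G R = (\<lambda>N. N \<lhd> G) hull R"

text \<open>The group with generating set \<open>S\<close> and set of relators \<open>R\<close>, where \<open>R\<close> is a subset of the
  free group on \<open>S\<close>.\<close>

definition presented_group :: "'a set \<Rightarrow> 'a word set set \<Rightarrow> 'a word set set monoid" where
  "presented_group S R = free_group S Mod normal_closure (free_group S) R"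

definition commutator :: "('g, 'm) monoid_scheme \<Rightarrow> 'g \<Rightarrow> 'g \<Rightarrow> 'g" where
  "commutator G a b = a \<otimes>\<^bsub>G\<^esub> b \<otimes>\<^bsub>G\<^esub> inv\<^bsub>G\<^esub> a \<otimes>\<^bsub>G\<^esub> inv\<^bsub>G\<^esub> b"


section \<open>Diagrams, Artin groups and Coxeter groups\<close>

text \<open>Diagrams in which every edge is single or double; an edge is given as the two-element set of
  its end points.\<close>

record 'v diagram =
  vertices :: "'v set"
  single_edges :: "'v set set"
  double_edges :: "'v set set"

definition braid_length :: "'v diagram \<Rightarrow> 'v \<Rightarrow> 'v \<Rightarrow> nat" where
  "braid_length D s t =
     (if {s, t} \<in> double_edges D then 4 else if {s, t} \<in> single_edges D then 3 else 2)"

text \<open>The product \<open>a b a \<dots>\<close> with \<open>n\<close> alternating factors, starting with \<open>a\<close>.\<close>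

primrec alternating :: "('g, 'm) monoid_scheme \<Rightarrow> nat \<Rightarrow> 'g \<Rightarrow> 'g \<Rightarrow> 'g" where
  "alternating G 0 a b = \<one>\<^bsub>G\<^esub>"
| "alternating G (Suc n) a b = a \<otimes>\<^bsub>G\<^esub> alternating G n b a"

text \<open>The relation \<open>sts\<dots> = tst\<dots>\<close> is encoded by the relator \<open>(sts\<dots>)(tst\<dots>)\<inverse>\<close>.\<close>

definition braid_relators :: "'v diagram \<Rightarrow> 'v word set set" where
  "braid_relators D =
     (let F = free_group (vertices D); g = free_gen (vertices D) in
      {alternating F (braid_length D s t) (g s) (g t) \<otimes>\<^bsub>F\<^esub>
       inv\<^bsub>F\<^esub> (alternating F (braid_length D s t) (g t) (g s))
       | s t. s \<in> vertices D \<and> t \<in> vertices D \<and> s \<noteq> t})"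

definition artin_group :: "'v diagram \<Rightarrow> 'v word set set monoid" where
  "artin_group D = presented_group (vertices D) (braid_relators D)"

definition coxeter_group :: "'v diagram \<Rightarrow> 'v word set set monoid" where
  "coxeter_group D = presented_group (vertices D)
     (braid_relators D \<union>
      {free_gen (vertices D) s \<otimes>\<^bsub>free_group (vertices D)\<^esub> free_gen (vertices D) s
       | s. s \<in> vertices D})"

definition F4 :: "nat diagram" where
  "F4 = \<lparr>vertices = {1, 2, 3, 4}, single_edges = {{1, 2}, {3, 4}}, double_edges = {{2, 3}}\<rparr>"

definition F4_a1 :: "'v \<Rightarrow> 'v \<Rightarrow> 'v \<Rightarrow> 'v \<Rightarrow> 'v diagram" where
  "F4_a1 s1 s2 s3 s4 = \<lparr>vertices = {s1, s2, s3, s4},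
     single_edges = {{s1, s2}, {s3, s4}}, double_edges = {{s1, s4}, {s2, s3}}\<rparr>"


section \<open>The free group is a group with the expected universal property\<close>

lemma words_simps [simp]:
  "[] \<in> words S"
  "x # u \<in> words S \<longleftrightarrow> fst x \<in> S \<and> u \<in> words S"
  "u @ v \<in> words S \<longleftrightarrow> u \<in> words S \<and> v \<in> words S"
  by (simp_all add: words_def mem_Times_iff)

lemma cancels_append:
  assumes "cancels S u u'"
  shows "cancels S (p @ u @ q) (p @ u' @ q)"
  using assms
proof cases
  case (1 a w e v)
  then show ?thesis using cancels.intros[of a S "p @ w" e "v @ q"] by simp
qed

lemma equivclp_append: "equivclp (cancels S) u u' \<Longrightarrow> equivclp (cancels S) (p @ u @ q) (p @ u' @ q)"
proof (induction rule: equivclp_induct)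
  case base then show ?case by simp
next
  case (step y z)
  then show ?case by (meson cancels_append equivclp_into_equivclp)
qed

lemma equiv_free_rel: "equiv (words S) (free_rel S)"
proof (rule equivI)
  show "sym (free_rel S)"
    unfolding free_rel_def by (rule symI) (use equivclp_sym in fast)
  show "trans (free_rel S)"
    unfolding free_rel_def by (rule transI) (use equivclp_trans in fast)
qed (auto simp: free_rel_def refl_on_def)

lemma free_rel_append:
  assumes "(u, u') \<in> free_rel S" "(v, v') \<in> free_rel S"
  shows "(u @ v, u' @ v') \<in> free_rel S"
proof -
  have "equivclp (cancels S) (u @ v) (u' @ v)"
    using assms equivclp_append[of S u u' "[]" v] by (auto simp: free_rel_def)
  moreover have "equivclp (cancels S) (u' @ v) (u' @ v')"
    using assms equivclp_append[of S v v' u' "[]"] by (auto simp: free_rel_def)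
  ultimately have "equivclp (cancels S) (u @ v) (u' @ v')"
    by (rule equivclp_trans)
  with assms show ?thesis
    by (simp add: free_rel_def)
qed

lemma free_mult:
  assumes "u \<in> words S" "v \<in> words S"
  shows "free_rel S `` {u} \<otimes>\<^bsub>free_group S\<^esub> free_rel S `` {v} = free_rel S `` {u @ v}"
proof -
  have "free_rel S `` {u' @ v'} = free_rel S `` {u @ v}"
    if "(u, u') \<in> free_rel S" "(v, v') \<in> free_rel S" for u' v'
    using free_rel_append[OF that] equiv_class_eq[OF equiv_free_rel] by metis
  then have "(\<Union>u'\<in>free_rel S `` {u}. \<Union>v'\<in>free_rel S `` {v}. free_rel S `` {u' @ v'})
      = (\<Union>u'\<in>free_rel S `` {u}. \<Union>v'\<in>free_rel S `` {v}. free_rel S `` {u @ v})"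
    by simp
  moreover have "u \<in> free_rel S `` {u}" "v \<in> free_rel S `` {v}"
    using assms by (simp_all add: free_rel_def)
  ultimately show ?thesis
    unfolding free_group_def by auto
qed

definition word_inv :: "'a word \<Rightarrow> 'a word" where
  "word_inv u = rev (map (\<lambda>(a, e). (a, \<not> e)) u)"

lemma word_inv_words: "u \<in> words S \<Longrightarrow> word_inv u \<in> words S"
  by (induction u) (auto simp: word_inv_def)

lemma word_inv_left: "u \<in> words S \<Longrightarrow> equivclp (cancels S) (word_inv u @ u) []"
proof (induction u)
  case Nil then show ?case by (simp add: word_inv_def)
next
  case (Cons x u)
  obtain a e where x: "x = (a, e)" by fastforce
  have "cancels S (word_inv u @ [(a, \<not> e), (a, \<not> \<not> e)] @ u) (word_inv u @ u)"
    using Cons x by (intro cancels.intros) simp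
  then have "cancels S (word_inv (x # u) @ x # u) (word_inv u @ u)"
    by (simp add: word_inv_def x)
  with Cons show ?case by (meson equivclp_trans r_into_equivclp words_simps(2))
qed

lemma free_group_carrier: "carrier (free_group S) = words S // free_rel S"
  and free_group_one: "\<one>\<^bsub>free_group S\<^esub> = free_rel S `` {[]}"
  by (simp_all add: free_group_def)

lemma group_free_group: "group (free_group S)"
proof (rule groupI)
  fix x assume "x \<in> carrier (free_group S)"
  then obtain u where u: "u \<in> words S" "x = free_rel S `` {u}"
    unfolding free_group_carrier by (elim quotientE)
  have "(word_inv u @ u, []) \<in> free_rel S"
    using u word_inv_left[of u S] word_inv_words[of u S] by (auto simp: free_rel_def)
  then have "free_rel S `` {word_inv u} \<otimes>\<^bsub>free_group S\<^esub> x = \<one>\<^bsub>free_group S\<^esub>"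
    using u word_inv_words[of u S] by (simp add: free_mult free_group_one equiv_class_eq[OF equiv_free_rel])
  then show "\<exists>y\<in>carrier (free_group S). y \<otimes>\<^bsub>free_group S\<^esub> x = \<one>\<^bsub>free_group S\<^esub>"
    using u word_inv_words[of u S] by (auto simp: free_group_carrier intro: quotientI)
next
  fix x y assume "x \<in> carrier (free_group S)" "y \<in> carrier (free_group S)"
  then show "x \<otimes>\<^bsub>free_group S\<^esub> y \<in> carrier (free_group S)"
    unfolding free_group_carrier by (elim quotientE) (simp add: free_mult quotientI)
next
  fix x y z assume "x \<in> carrier (free_group S)" "y \<in> carrier (free_group S)"
    "z \<in> carrier (free_group S)"
  then show "x \<otimes>\<^bsub>free_group S\<^esub> y \<otimes>\<^bsub>free_group S\<^esub> z
    = x \<otimes>\<^bsub>free_group S\<^esub> (y \<otimes>\<^bsub>free_group S\<^esub> z)"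
    unfolding free_group_carrier by (elim quotientE) (simp add: free_mult)
next
  show "\<one>\<^bsub>free_group S\<^esub> \<in> carrier (free_group S)"
    by (simp add: free_group_carrier free_group_one quotientI)
next
  fix x assume "x \<in> carrier (free_group S)"
  then show "\<one>\<^bsub>free_group S\<^esub> \<otimes>\<^bsub>free_group S\<^esub> x = x"
    unfolding free_group_carrier free_group_one by (elim quotientE) (simp add: free_mult)
qed

lemma free_gen_closed: "a \<in> S \<Longrightarrow> free_gen S a \<in> carrier (free_group S)"
  by (simp add: free_gen_def free_group_carrier quotientI)

text \<open>Evaluation of words in a group \<open>G\<close> under a map from the letters to \<open>G\<close>.\<close>

definition word_eval :: "('g, 'm) monoid_scheme \<Rightarrow> ('a \<Rightarrow> 'g) \<Rightarrow> 'a word \<Rightarrow> 'g" where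
  "word_eval G f u =
     foldr (\<lambda>(a, e) x. (if e then f a else inv\<^bsub>G\<^esub> f a) \<otimes>\<^bsub>G\<^esub> x) u \<one>\<^bsub>G\<^esub>"

context group
begin

lemma word_eval_closed: "f \<in> S \<rightarrow> carrier G \<Longrightarrow> u \<in> words S \<Longrightarrow> word_eval G f u \<in> carrier G"
  by (induction u) (auto simp: word_eval_def Pi_iff)

lemma word_eval_append:
  "f \<in> S \<rightarrow> carrier G \<Longrightarrow> u \<in> words S \<Longrightarrow> v \<in> words S \<Longrightarrow>
   word_eval G f (u @ v) = word_eval G f u \<otimes> word_eval G f v"
proof (induction u)
  case Nil then show ?case using word_eval_closed[of f S v] by (simp add: word_eval_def)
next
  case (Cons x u)
  then have "word_eval G f u \<in> carrier G" "word_eval G f v \<in> carrier G"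
    using word_eval_closed[of f S] by auto
  with Cons show ?case by (cases x) (auto simp: word_eval_def m_assoc Pi_iff)
qed

lemma word_eval_cancels:
  assumes "cancels S u v" "f \<in> S \<rightarrow> carrier G"
  shows "(u \<in> words S \<longleftrightarrow> v \<in> words S) \<and> (u \<in> words S \<longrightarrow> word_eval G f u = word_eval G f v)"
  using assms(1)
proof cases
  case (1 a p e q)
  have fa: "f a \<in> carrier G" using 1 assms(2) by auto
  have "word_eval G f ([(a, e), (a, \<not> e)] @ q) = word_eval G f q" if "q \<in> words S"
    using fa word_eval_closed[OF assms(2) that]
    by (cases e) (simp_all add: word_eval_def m_assoc[symmetric])
  moreover have "[(a, e), (a, \<not> e)] @ q \<in> words S" if "q \<in> words S"
    using 1 that by simp
  ultimately show ?thesis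
    using 1 word_eval_append[OF assms(2)] by (auto simp del: append_Cons append_Nil)
qed

lemma word_eval_equivclp:
  assumes "equivclp (cancels S) u v" "f \<in> S \<rightarrow> carrier G" "u \<in> words S"
  shows "v \<in> words S \<and> word_eval G f u = word_eval G f v"
  using assms(1)
proof (induction rule: equivclp_induct)
  case base then show ?case using assms(3) by simp
next
  case (step y z)
  then show ?case using word_eval_cancels[OF _ assms(2)] by metis
qed

theorem free_group_universal:
  assumes f: "f \<in> S \<rightarrow> carrier G"
  shows "\<exists>h \<in> hom (free_group S) G. \<forall>a\<in>S. h (free_gen S a) = f a"
proof -
  define h where "h = (\<lambda>A. word_eval G f (SOME u. u \<in> A))"
  have h: "h (free_rel S `` {u}) = word_eval G f u" if "u \<in> words S" for u
  proof -
    have "u \<in> free_rel S `` {u}" using that by (auto simp: free_rel_def)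
    then have "(SOME v. v \<in> free_rel S `` {u}) \<in> free_rel S `` {u}" by (rule someI)
    then show ?thesis
      using word_eval_equivclp[OF _ f that] by (auto simp: h_def free_rel_def)
  qed
  have "h \<in> hom (free_group S) G"
    unfolding hom_def free_group_carrier
    by (safe elim!: quotientE)
      (simp_all add: free_mult h word_eval_closed[OF f] word_eval_append[OF f])
  moreover have "\<forall>a\<in>S. h (free_gen S a) = f a"
    using f by (auto simp: free_gen_def h) (auto simp: word_eval_def Pi_iff)
  ultimately show ?thesis by blast
qed

end

end

theory Submission
  imports Defs
begin

text \<open>
  Commuting elements \<open>a\<close>, \<open>b\<close> of a group satisfy \<open>abab = baba\<close>. Hence, once \<open>s\<^sub>2\<close> and \<open>s\<^sub>3\<close> commute, the
  braid relation of length four on the double edge \<open>s\<^sub>2s\<^sub>3\<close> of the 4-cycle follows, and adding the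
  commutator amounts to replacing that relation by the one of length two, that is, to deleting
  the edge. What remains is the path \<open>s\<^sub>2 - s\<^sub>1 = s\<^sub>4 - s\<^sub>3\<close> with its double edge in the middle,
  which is the diagram \<open>F\<^sub>4\<close> with its vertices renamed.

  Deleting the edge instead of adding the commutator gives the same normal closure, since a normal
  subgroup contains the one set of relators iff it contains the other
  (lemma \<open>artin_group_delete_double_edge\<close>). Renaming the vertices yields an isomorphism by the
  universal property of the presentation (lemma \<open>artin_group_relabel\<close>). Both arguments read
  ``a homomorphism kills the braid relators'' as ``the images of the generators satisfy the
  braid relations'' (lemma \<open>braid_relators_kernel\<close>).
\<close>

section \<open>Normal subgroups and normal closures\<close>

lemma (in group) normal_Inter:
  assumes "\<And>N. N \<in> A \<Longrightarrow> N \<lhd> G" "A \<noteq> {}"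
  shows "\<Inter>A \<lhd> G"
  unfolding normal_inv_iff
proof (intro conjI ballI)
  show "subgroup (\<Inter>A) G"
    using assms normal_imp_subgroup by (intro subgroups_Inter) blast+
  fix x h assume "x \<in> carrier G" "h \<in> \<Inter>A"
  then show "x \<otimes> h \<otimes> inv x \<in> \<Inter>A"
    using assms(1) normal_inv_iff by auto
qed

lemma (in group) normal_carrier: "carrier G \<lhd> G"
  by (simp add: normal_inv_iff subgroup_self)

lemma (in group) normal_normal_closure:
  assumes "R \<subseteq> carrier G"
  shows "normal_closure G R \<lhd> G"
  unfolding normal_closure_def hull_def
  using assms normal_carrier by (intro normal_Inter) auto

lemma normal_closure_superset: "R \<subseteq> normal_closure G R"
  unfolding normal_closure_def by (rule hull_subset)

lemma normal_closure_least: "N \<lhd> G \<Longrightarrow> R \<subseteq> N \<Longrightarrow> normal_closure G R \<subseteq> N"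
  unfolding normal_closure_def by (rule hull_minimal)

lemma normal_closure_cong:
  assumes "\<And>N. N \<lhd> G \<Longrightarrow> R \<subseteq> N \<longleftrightarrow> R' \<subseteq> N"
  shows "normal_closure G R = normal_closure G R'"
proof -
  have "{N. N \<lhd> G \<and> R \<subseteq> N} = {N. N \<lhd> G \<and> R' \<subseteq> N}"
    using assms by auto
  then show ?thesis
    by (simp add: normal_closure_def hull_def)
qed

lemma (in normal) group_hom_r_coset: "group_hom G (G Mod H) (\<lambda>x. H #> x)"
  by (simp add: group_hom_def group_hom_axioms_def is_group factorgroup_is_group r_coset_hom_Mod)

lemma (in normal) kernel_r_coset: "kernel G (G Mod H) (\<lambda>x. H #> x) = H"
proof -
  have "H #> x = H \<longleftrightarrow> x \<in> H" if "x \<in> carrier G" for x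
    using that coset_join1 coset_join2 subgroup_axioms by blast
  then show ?thesis
    using subset by (simp add: kernel_def) blast
qed

section \<open>Alternating products and commutators\<close>

context group
begin

lemma alternating_closed:
  "a \<in> carrier G \<Longrightarrow> b \<in> carrier G \<Longrightarrow> alternating G n a b \<in> carrier G"
  by (induction n arbitrary: a b) auto

lemma alternating_2: "a \<in> carrier G \<Longrightarrow> b \<in> carrier G \<Longrightarrow> alternating G 2 a b = a \<otimes> b"
  by (simp add: numeral_2_eq_2)

lemma alternating_4_commute:
  assumes "a \<in> carrier G" "b \<in> carrier G" "a \<otimes> b = b \<otimes> a"
  shows "alternating G 4 a b = alternating G 4 b a"
proof -
  have "alternating G 4 x y = (x \<otimes> y) \<otimes> (x \<otimes> y)"
    if "x \<in> carrier G" "y \<in> carrier G" for x y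
    using that by (simp add: eval_nat_numeral m_assoc)
  with assms show ?thesis by simp
qed

lemma mult_inv_eq_one_iff:
  assumes "x \<in> carrier G" "y \<in> carrier G"
  shows "x \<otimes> inv y = \<one> \<longleftrightarrow> x = y"
  using assms by (metis inv_equality inv_inv inv_closed r_inv)

lemma commutator_closed:
  "a \<in> carrier G \<Longrightarrow> b \<in> carrier G \<Longrightarrow> commutator G a b \<in> carrier G"
  by (simp add: commutator_def)

lemma commutator_eq_one_iff:
  assumes "a \<in> carrier G" "b \<in> carrier G"
  shows "commutator G a b = \<one> \<longleftrightarrow> a \<otimes> b = b \<otimes> a"
proof -
  have "commutator G a b = (a \<otimes> b) \<otimes> inv (b \<otimes> a)"
    using assms by (simp add: commutator_def inv_mult_group m_assoc)
  with assms show ?thesis by (simp add: mult_inv_eq_one_iff)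
qed

end

context group_hom
begin

lemma hom_alternating:
  "a \<in> carrier G \<Longrightarrow> b \<in> carrier G \<Longrightarrow> h (alternating G n a b) = alternating H n (h a) (h b)"
  by (induction n arbitrary: a b) (simp_all add: G.alternating_closed)

lemma hom_commutator:
  "a \<in> carrier G \<Longrightarrow> b \<in> carrier G \<Longrightarrow> h (commutator G a b) = commutator H (h a) (h b)"
  by (simp add: commutator_def)

end

section \<open>Homomorphisms out of a free group\<close>

lemma free_group_induct [consumes 1, case_names one gen inv_gen]:
  assumes "x \<in> carrier (free_group S)"
    and "P \<one>\<^bsub>free_group S\<^esub>"
    and gen: "\<And>a y. a \<in> S \<Longrightarrow> y \<in> carrier (free_group S) \<Longrightarrow> P y \<Longrightarrow>
      P (free_gen S a \<otimes>\<^bsub>free_group S\<^esub> y)"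
    and inv_gen: "\<And>a y. a \<in> S \<Longrightarrow> y \<in> carrier (free_group S) \<Longrightarrow> P y \<Longrightarrow>
      P (inv\<^bsub>free_group S\<^esub> free_gen S a \<otimes>\<^bsub>free_group S\<^esub> y)"
  shows "P x"
proof -
  interpret F: group "free_group S" by (rule group_free_group)
  have inv_class: "free_rel S `` {[(a, False)]} = inv\<^bsub>free_group S\<^esub> free_gen S a" if "a \<in> S" for a
  proof -
    have "cancels S [(a, False), (a, True)] []"
      using cancels.intros[of a S "[]" False "[]"] that by simp
    then have "([(a, False), (a, True)], []) \<in> free_rel S"
      using that by (simp add: free_rel_def r_into_equivclp)
    then have "free_rel S `` {[(a, False)]} \<otimes>\<^bsub>free_group S\<^esub> free_gen S a = \<one>\<^bsub>free_group S\<^esub>"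
      using that by (simp add: free_gen_def free_mult free_group_one
          equiv_class_eq[OF equiv_free_rel])
    moreover have "free_rel S `` {[(a, False)]} \<in> carrier (free_group S)"
      using that by (simp add: free_group_carrier quotientI)
    ultimately show ?thesis
      using that by (simp add: F.inv_equality free_gen_closed)
  qed
  obtain u where u: "u \<in> words S" "x = free_rel S `` {u}"
    using assms(1) unfolding free_group_carrier by (elim quotientE)
  have "P (free_rel S `` {u})"
    using u(1)
  proof (induction u)
    case Nil
    then show ?case using assms(2) by (simp add: free_group_one)
  next
    case (Cons l u)
    obtain a e where l: "l = (a, e)" by fastforce
    with Cons have "a \<in> S" "u \<in> words S" by simp_all
    then have carrier: "free_rel S `` {u} \<in> carrier (free_group S)"
      by (simp add: free_group_carrier quotientI)
    have "free_rel S `` {l # u} = free_rel S `` {[l]} \<otimes>\<^bsub>free_group S\<^esub> free_rel S `` {u}"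
      using \<open>a \<in> S\<close> \<open>u \<in> words S\<close> l by (simp add: free_mult)
    then show ?case
      using gen[OF \<open>a \<in> S\<close> carrier] inv_gen[OF \<open>a \<in> S\<close> carrier] Cons \<open>a \<in> S\<close> l
        inv_class[of a] by (cases e) (simp_all add: free_gen_def)
  qed
  with u show ?thesis by simp
qed

lemma free_group_hom_eq:
  assumes "group G" "h \<in> hom (free_group S) G" "k \<in> hom (free_group S) G"
    and agree: "\<And>a. a \<in> S \<Longrightarrow> h (free_gen S a) = k (free_gen S a)"
    and "x \<in> carrier (free_group S)"
  shows "h x = k x"
proof -
  interpret F: group "free_group S" by (rule group_free_group)
  interpret G: group G by fact
  interpret h: group_hom "free_group S" G h by unfold_locales fact
  interpret k: group_hom "free_group S" G k by unfold_locales fact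
  show ?thesis
    using assms(5) by (induction rule: free_group_induct) (simp_all add: free_gen_closed agree)
qed

section \<open>Braid relations and the universal property of Artin groups\<close>

definition satisfies_braid_relations ::
    "('g, 'm) monoid_scheme \<Rightarrow> 'v diagram \<Rightarrow> ('v \<Rightarrow> 'g) \<Rightarrow> bool" where
  "satisfies_braid_relations G D f \<longleftrightarrow>
     (\<forall>s\<in>vertices D. \<forall>t\<in>vertices D. s \<noteq> t \<longrightarrow>
        alternating G (braid_length D s t) (f s) (f t) =
        alternating G (braid_length D s t) (f t) (f s))"

lemma braid_relators_closed: "braid_relators D \<subseteq> carrier (free_group (vertices D))"
proof -
  interpret F: group "free_group (vertices D)" by (rule group_free_group)
  show ?thesis
    by (auto simp: braid_relators_def Let_def F.alternating_closed free_gen_closed)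
qed

text \<open>The relator \<open>x y\<inverse>\<close> is mapped to the identity iff the images of \<open>x\<close> and \<open>y\<close> coincide, and a
  homomorphism commutes with alternating products.\<close>

lemma braid_relators_kernel:
  assumes "group_hom (free_group (vertices D)) G h"
  shows "braid_relators D \<subseteq> kernel (free_group (vertices D)) G h \<longleftrightarrow>
    satisfies_braid_relations G D (\<lambda>a. h (free_gen (vertices D) a))"
proof -
  let ?F = "free_group (vertices D)" and ?g = "free_gen (vertices D)"
  interpret h: group_hom ?F G h by fact
  have "alternating ?F n (?g s) (?g t) \<otimes>\<^bsub>?F\<^esub> inv\<^bsub>?F\<^esub> (alternating ?F n (?g t) (?g s))
        \<in> kernel ?F G h \<longleftrightarrow>
      alternating G n (h (?g s)) (h (?g t)) = alternating G n (h (?g t)) (h (?g s))"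
    if "s \<in> vertices D" "t \<in> vertices D" for s t n
    using that
    by (simp add: kernel_def free_gen_closed h.G.alternating_closed h.hom_alternating
        h.H.alternating_closed h.H.mult_inv_eq_one_iff)
  then show ?thesis
    by (simp add: subset_eq braid_relators_def satisfies_braid_relations_def Let_def) metis
qed

definition artin_gen :: "'v diagram \<Rightarrow> 'v \<Rightarrow> 'v word set set" where
  "artin_gen D a = normal_closure (free_group (vertices D)) (braid_relators D)
     #>\<^bsub>free_group (vertices D)\<^esub> free_gen (vertices D) a"

lemma normal_braid_closure:
  "normal_closure (free_group (vertices D)) (braid_relators D) \<lhd> free_group (vertices D)"
  by (intro group.normal_normal_closure group_free_group braid_relators_closed)

lemma group_artin_group: "group (artin_group D)"
  unfolding artin_group_def presented_group_def
  by (rule normal.factorgroup_is_group[OF normal_braid_closure])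

lemma artin_gen_closed: "a \<in> vertices D \<Longrightarrow> artin_gen D a \<in> carrier (artin_group D)"
  by (simp add: artin_gen_def artin_group_def presented_group_def carrier_FactGroup free_gen_closed)

lemma artin_gen_satisfies_braid_relations:
  "satisfies_braid_relations (artin_group D) D (artin_gen D)"
  using normal_closure_superset[of "braid_relators D" "free_group (vertices D)"]
    braid_relators_kernel[OF normal.group_hom_r_coset[OF normal_braid_closure[of D]]]
  by (simp add: normal.kernel_r_coset[OF normal_braid_closure] artin_gen_def [abs_def]
      artin_group_def presented_group_def)

lemma artin_group_universal:
  assumes "group G" "f \<in> vertices D \<rightarrow> carrier G" "satisfies_braid_relations G D f"
  obtains k where "k \<in> hom (artin_group D) G" "\<And>a. a \<in> vertices D \<Longrightarrow> k (artin_gen D a) = f a"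
proof -
  let ?F = "free_group (vertices D)"
  obtain h where h: "h \<in> hom ?F G" "\<And>a. a \<in> vertices D \<Longrightarrow> h (free_gen (vertices D) a) = f a"
    using group.free_group_universal[OF assms(1,2)] by blast
  interpret h: group_hom ?F G h
    by (simp add: group_hom_def group_hom_axioms_def group_free_group assms(1) h(1))
  have "satisfies_braid_relations G D (\<lambda>a. h (free_gen (vertices D) a))"
    using assms(3) h(2) by (simp add: satisfies_braid_relations_def)
  then have "normal_closure ?F (braid_relators D) \<subseteq> kernel ?F G h"
    by (intro normal_closure_least h.normal_kernel)
      (simp add: braid_relators_kernel[OF h.group_hom_axioms])
  then obtain k where k: "k \<in> hom (artin_group D) G"
      "\<And>x. x \<in> carrier ?F \<Longrightarrow>
        k (normal_closure ?F (braid_relators D) #>\<^bsub>?F\<^esub> x) = h x"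
    using h.FactGroup_universal_kernel[OF normal_braid_closure]
    unfolding artin_group_def presented_group_def by metis
  have "k (artin_gen D a) = f a" if "a \<in> vertices D" for a
    using k(2)[OF free_gen_closed[OF that]] h(2)[OF that] unfolding artin_gen_def by simp
  with k(1) show thesis
    by (rule that)
qed

lemma artin_group_hom_eq:
  assumes "group G" "h \<in> hom (artin_group D) G" "k \<in> hom (artin_group D) G"
    and agree: "\<And>a. a \<in> vertices D \<Longrightarrow> h (artin_gen D a) = k (artin_gen D a)"
    and x: "x \<in> carrier (artin_group D)"
  shows "h x = k x"
proof -
  let ?F = "free_group (vertices D)"
  let ?p = "\<lambda>y. normal_closure ?F (braid_relators D) #>\<^bsub>?F\<^esub> y"
  have p: "?p \<in> hom ?F (artin_group D)"
    unfolding artin_group_def presented_group_def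
    by (rule normal.r_coset_hom_Mod[OF normal_braid_closure])
  obtain y where y: "y \<in> carrier ?F" "x = ?p y"
    using x unfolding artin_group_def presented_group_def carrier_FactGroup by blast
  have hom: "h \<circ> ?p \<in> hom ?F G" "k \<circ> ?p \<in> hom ?F G"
    using p assms(2,3) by (blast intro: hom_compose)+
  have gens: "(h \<circ> ?p) (free_gen (vertices D) a) = (k \<circ> ?p) (free_gen (vertices D) a)"
    if "a \<in> vertices D" for a
    using agree[OF that] by (simp only: artin_gen_def o_apply)
  have "(h \<circ> ?p) y = (k \<circ> ?p) y"
    by (rule free_group_hom_eq[OF assms(1) hom gens y(1)])
  with y show ?thesis by simp
qed

section \<open>Relabelling vertices and deleting a double edge\<close>

lemma artin_group_relabel_hom:
  assumes "f ` vertices D \<subseteq> vertices D'" "inj_on f (vertices D)"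
    and "\<And>s t. s \<in> vertices D \<Longrightarrow> t \<in> vertices D \<Longrightarrow> s \<noteq> t \<Longrightarrow>
      braid_length D' (f s) (f t) = braid_length D s t"
  obtains k where "k \<in> hom (artin_group D) (artin_group D')"
    "\<And>a. a \<in> vertices D \<Longrightarrow> k (artin_gen D a) = artin_gen D' (f a)"
proof (rule artin_group_universal[of "artin_group D'" "\<lambda>a. artin_gen D' (f a)" D])
  show "satisfies_braid_relations (artin_group D') D (\<lambda>a. artin_gen D' (f a))"
    unfolding satisfies_braid_relations_def
  proof (intro ballI impI)
    fix s t assume st: "s \<in> vertices D" "t \<in> vertices D" "s \<noteq> t"
    then have "f s \<in> vertices D'" "f t \<in> vertices D'" "f s \<noteq> f t"
      using assms(1,2) by (auto dest: inj_onD)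
    then show "alternating (artin_group D') (braid_length D s t) (artin_gen D' (f s)) (artin_gen D' (f t))
        = alternating (artin_group D') (braid_length D s t) (artin_gen D' (f t)) (artin_gen D' (f s))"
      using artin_gen_satisfies_braid_relations[of D'] assms(3)[OF st]
      unfolding satisfies_braid_relations_def by metis
  qed
qed (use assms(1) that in \<open>auto simp: group_artin_group artin_gen_closed\<close>)

text \<open>The homomorphisms induced by a relabelling and by its inverse compose to homomorphisms that
  fix every generator, hence to the identity.\<close>

lemma artin_group_relabel:
  assumes bij: "bij_betw f (vertices D) (vertices D')"
    and len: "\<And>s t. s \<in> vertices D \<Longrightarrow> t \<in> vertices D \<Longrightarrow> s \<noteq> t \<Longrightarrow>
      braid_length D' (f s) (f t) = braid_length D s t"
  shows "artin_group D \<cong> artin_group D'"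
proof -
  let ?f' = "inv_into (vertices D) f"
  have bij': "bij_betw ?f' (vertices D') (vertices D)"
    using bij by (rule bij_betw_inv_into)
  have f'f: "?f' (f a) = a" "f a \<in> vertices D'" if "a \<in> vertices D" for a
    using bij that by (auto simp: bij_betw_inv_into_left bij_betw_apply)
  have ff': "f (?f' b) = b" "?f' b \<in> vertices D" if "b \<in> vertices D'" for b
    using bij bij' that by (auto simp: bij_betw_inv_into_right bij_betw_apply)
  obtain h where h: "h \<in> hom (artin_group D) (artin_group D')"
      "\<And>a. a \<in> vertices D \<Longrightarrow> h (artin_gen D a) = artin_gen D' (f a)"
    using artin_group_relabel_hom[of f D D'] bij len by (auto simp: bij_betw_def)
  have len': "braid_length D (?f' s) (?f' t) = braid_length D' s t"
    if "s \<in> vertices D'" "t \<in> vertices D'" "s \<noteq> t" for s t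
    using len[of "?f' s" "?f' t"] ff' that by metis
  obtain k where k: "k \<in> hom (artin_group D') (artin_group D)"
      "\<And>b. b \<in> vertices D' \<Longrightarrow> k (artin_gen D' b) = artin_gen D (?f' b)"
    using artin_group_relabel_hom[of ?f' D' D] bij' len' by (auto simp: bij_betw_def)
  have id: "(\<lambda>x. x) \<in> hom K K" for K :: "'c monoid"
    by (simp add: hom_def)
  have "k (h x) = x" if "x \<in> carrier (artin_group D)" for x
  proof -
    have "(k \<circ> h) x = x"
      using that
      by (rule artin_group_hom_eq[OF group_artin_group hom_compose[OF h(1) k(1)] id, rotated])
        (simp add: h(2) k(2) f'f)
    then show ?thesis by simp
  qed
  moreover have "h (k y) = y" if "y \<in> carrier (artin_group D')" for y
  proof -
    have "(h \<circ> k) y = y"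
      using that
      by (rule artin_group_hom_eq[OF group_artin_group hom_compose[OF k(1) h(1)] id, rotated])
        (simp add: h(2) k(2) ff')
    then show ?thesis by simp
  qed
  ultimately have "group_isomorphisms (artin_group D) (artin_group D') h k"
    using h(1) k(1) by (simp add: group_isomorphisms_def)
  then show ?thesis
    by (metis group_isomorphisms_imp_iso is_isoI)
qed

text \<open>For a normal subgroup \<open>N\<close> of the free group, both sets of relators lie in \<open>N\<close> under the same
  condition. Without the edge, the relation between \<open>s\<close> and \<open>t\<close> says exactly that their images in the
  quotient commute. With the edge, the commutator says this, and it makes the relation \<open>stst = tsts\<close>
  redundant. So the two normal closures are equal, and the two presented groups are the same
  object, not only isomorphic.\<close>

lemma artin_group_delete_double_edge:
  fixes D :: "'v diagram"
  assumes st: "s \<in> vertices D" "t \<in> vertices D" "s \<noteq> t"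
    and edge: "{s, t} \<in> double_edges D" "{s, t} \<notin> single_edges D"
  defines "D' \<equiv> D\<lparr>double_edges := double_edges D - {{s, t}}\<rparr>"
  shows "presented_group (vertices D)
      (braid_relators D \<union> {commutator (free_group (vertices D))
         (free_gen (vertices D) s) (free_gen (vertices D) t)}) = artin_group D'"
proof -
  let ?F = "free_group (vertices D)" and ?g = "free_gen (vertices D)"
  have V: "vertices D' = vertices D" by (simp add: D'_def)
  have len_edge: "braid_length D u v = 4" "braid_length D' u v = 2" if "{u, v} = {s, t}" for u v
    using edge that by (auto simp: braid_length_def D'_def)
  have len_other: "braid_length D' u v = braid_length D u v" if "{u, v} \<noteq> {s, t}" for u v
    using that by (simp add: braid_length_def D'_def)
  have "braid_relators D \<union> {commutator ?F (?g s) (?g t)} \<subseteq> N \<longleftrightarrow> braid_relators D' \<subseteq> N"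
    if "N \<lhd> ?F" for N
  proof -
    let ?Q = "?F Mod N" and ?p = "\<lambda>x. N #>\<^bsub>?F\<^esub> x"
    interpret p: group_hom ?F ?Q ?p by (rule normal.group_hom_r_coset[OF that])
    have ker: "kernel ?F ?Q ?p = N" by (rule normal.kernel_r_coset[OF that])
    define f where "f = (\<lambda>a. ?p (?g a))"
    have f: "f a \<in> carrier ?Q" if "a \<in> vertices D" for a
      using p.hom_closed[OF free_gen_closed[OF that]] by (simp only: f_def)
    have comm: "commutator ?F (?g s) (?g t) \<in> N \<longleftrightarrow> f s \<otimes>\<^bsub>?Q\<^esub> f t = f t \<otimes>\<^bsub>?Q\<^esub> f s"
    proof -
      have "commutator ?F (?g s) (?g t) \<in> kernel ?F ?Q ?p \<longleftrightarrow>
          commutator ?Q (f s) (f t) = \<one>\<^bsub>?Q\<^esub>"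
        using st unfolding kernel_def f_def
        by (simp only: mem_Collect_eq p.hom_commutator free_gen_closed p.G.commutator_closed)
          simp
      then show ?thesis
        using st f by (simp only: ker p.H.commutator_eq_one_iff)
    qed
    have br: "braid_relators D \<subseteq> N \<longleftrightarrow> satisfies_braid_relations ?Q D f"
      using braid_relators_kernel[OF p.group_hom_axioms] by (simp only: ker f_def)
    have br': "braid_relators D' \<subseteq> N \<longleftrightarrow> satisfies_braid_relations ?Q D' f"
      using braid_relators_kernel[of D' ?Q ?p] p.group_hom_axioms by (simp only: V ker f_def)
    let ?rel = "\<lambda>n u v. alternating ?Q n (f u) (f v) = alternating ?Q n (f v) (f u)"
    have two: "?rel 2 u v \<longleftrightarrow> f s \<otimes>\<^bsub>?Q\<^esub> f t = f t \<otimes>\<^bsub>?Q\<^esub> f s"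
      and four: "f s \<otimes>\<^bsub>?Q\<^esub> f t = f t \<otimes>\<^bsub>?Q\<^esub> f s \<Longrightarrow> ?rel 4 u v"
      if "{u, v} = {s, t}" for u v
    proof -
      have uv: "u = s \<and> v = t \<or> u = t \<and> v = s"
        using that by (simp only: doubleton_eq_iff)
      note in_Q = f[OF st(1)] f[OF st(2)]
      show "?rel 2 u v \<longleftrightarrow> f s \<otimes>\<^bsub>?Q\<^esub> f t = f t \<otimes>\<^bsub>?Q\<^esub> f s"
        using uv p.H.alternating_2[OF in_Q] p.H.alternating_2[OF in_Q(2,1)] by metis
      show "?rel 4 u v" if "f s \<otimes>\<^bsub>?Q\<^esub> f t = f t \<otimes>\<^bsub>?Q\<^esub> f s"
        using uv p.H.alternating_4_commute[OF in_Q that] by metis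
    qed
    have "satisfies_braid_relations ?Q D' f \<longleftrightarrow>
        satisfies_braid_relations ?Q D f \<and> f s \<otimes>\<^bsub>?Q\<^esub> f t = f t \<otimes>\<^bsub>?Q\<^esub> f s"
      (is "?L \<longleftrightarrow> ?R \<and> ?C")
    proof
      assume L: ?L
      then have "?rel (braid_length D' s t) s t"
        using st unfolding satisfies_braid_relations_def V by blast
      then have C: ?C
        by (simp only: len_edge(2)[OF refl] two[OF refl])
      moreover have ?R
        unfolding satisfies_braid_relations_def
      proof (intro ballI impI)
        fix u v assume uv: "u \<in> vertices D" "v \<in> vertices D" "u \<noteq> v"
        show "?rel (braid_length D u v) u v"
        proof (cases "{u, v} = {s, t}")
          case True
          show ?thesis unfolding len_edge(1)[OF True] by (rule four[OF True C])
        next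
          case False
          show ?thesis
            using L uv unfolding satisfies_braid_relations_def V len_other[OF False, symmetric]
            by blast
        qed
      qed
      ultimately show "?R \<and> ?C" by blast
    next
      assume RC: "?R \<and> ?C"
      show ?L
        unfolding satisfies_braid_relations_def V
      proof (intro ballI impI)
        fix u v assume uv: "u \<in> vertices D" "v \<in> vertices D" "u \<noteq> v"
        show "?rel (braid_length D' u v) u v"
        proof (cases "{u, v} = {s, t}")
          case True
          show ?thesis unfolding len_edge(2)[OF True] two[OF True] using RC by blast
        next
          case False
          show ?thesis
            using RC uv unfolding satisfies_braid_relations_def len_other[OF False] by blast
        qed
      qed
    qed
    then show ?thesis
      using comm br br' by blast
  qed
  then have "normal_closure ?F (braid_relators D \<union> {commutator ?F (?g s) (?g t)})
      = normal_closure ?F (braid_relators D')"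
    by (rule normal_closure_cong)
  then show ?thesis
    by (simp only: artin_group_def presented_group_def V)
qed

section \<open>The presentation of the Artin group of type F4\<close>

theorem theorem2p24:
  fixes W :: "('w, 'm) monoid_scheme"
    and s1 s2 s3 s4 :: 'v
  assumes "group W" and "W \<cong> coxeter_group F4"
    and "distinct [s1, s2, s3, s4]"
  defines "\<Gamma> \<equiv> F4_a1 s1 s2 s3 s4"
  shows "artin_group F4 \<cong>
    presented_group (vertices \<Gamma>)
      (braid_relators \<Gamma> \<union>
       {commutator (free_group (vertices \<Gamma>)) (free_gen (vertices \<Gamma>) s2) (free_gen (vertices \<Gamma>) s3)})"
proof -
  let ?path = "\<Gamma>\<lparr>double_edges := double_edges \<Gamma> - {{s2, s3}}\<rparr>"
  have "presented_group (vertices \<Gamma>)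
      (braid_relators \<Gamma> \<union>
       {commutator (free_group (vertices \<Gamma>)) (free_gen (vertices \<Gamma>) s2) (free_gen (vertices \<Gamma>) s3)})
    = artin_group ?path"
    using assms(3)
    by (intro artin_group_delete_double_edge) (auto simp: \<Gamma>_def F4_a1_def doubleton_eq_iff)
  moreover have "artin_group F4 \<cong> artin_group ?path"
  proof (rule artin_group_relabel)
    \<comment> \<open>The path \<open>1 - 2 = 3 - 4\<close> is laid along \<open>s2 - s1 = s4 - s3\<close>.\<close>
    let ?f = "\<lambda>i::nat. if i = 1 then s2 else if i = 2 then s1 else if i = 3 then s4 else s3"
    show "bij_betw ?f (vertices F4) (vertices ?path)"
      using assms(3) by (auto simp: bij_betw_def inj_on_def F4_def \<Gamma>_def F4_a1_def)
    show "braid_length ?path (?f i) (?f j) = braid_length F4 i j"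
      if "i \<in> vertices F4" "j \<in> vertices F4" "i \<noteq> j" for i j
    proof -
      have "i \<in> {1, 2, 3, 4}" "j \<in> {1, 2, 3, 4}"
        using that by (simp_all add: F4_def)
      moreover have "s1 \<noteq> s2" "s1 \<noteq> s3" "s1 \<noteq> s4" "s2 \<noteq> s3" "s2 \<noteq> s4" "s3 \<noteq> s4"
        using assms(3) by auto
      moreover note this[symmetric]
      ultimately show ?thesis
        using \<open>i \<noteq> j\<close> unfolding braid_length_def F4_def \<Gamma>_def F4_a1_def
        by (elim insertE emptyE; hypsubst) (simp_all add: doubleton_eq_iff)
    qed
  qed
  ultimately show ?thesis by simp
qed

end
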